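(* Let $(d_1,\ldots,d_n)\in\mathbb{N}^n$, $m=\sum_i d_i$, let $k$ be a positive integer, and let $(x_1,\ldots,x_n)\in\mathbb{N}^n$ satisfy $0\le x_i\le d_i$ for all $i$ and $\sum_i x_i=k$. Then \[ \Bigl|\,H(d_1-x_1,\ldots,d_n-x_n)-H(d_1,\ldots,d_n)-\sum_i x_i\lg\frac{d_i}{m}\,\Bigr|\le \frac{2k}{\ln 2}. \]
   Context: $\lg=\log_2$. For nonnegative numbers $a_1,\ldots,a_n$ with $s=\sum_i a_i$, $H(a_1,\ldots,a_n)=\sum_i a_i\lg(s/a_i)$, with the convention $x\lg x=x\lg(1/x)=0$ for $x=0$ (terms with $x_i=0=d_i$ contribute $0$). *)

theory Defs
  imports Complex_Main
begin

abbreviation lg :: "real \<Rightarrow> real" where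
  "lg x \<equiv> log 2 x"

text \<open>
  The tuple \<open>(a\<^sub>1, \<dots>, a\<^sub>n)\<close> is a function restricted to the indices \<open>1, \<dots>, n\<close>.
  The convention \<open>0 lg (1/0) = 0\<close> needs no case distinction: in a term with \<open>a\<^sub>i = 0\<close>
  the factor \<open>a\<^sub>i\<close> multiplies a total function.
\<close>
definition H :: "nat \<Rightarrow> (nat \<Rightarrow> real) \<Rightarrow> real" where
  "H n a = (let s = (\<Sum>i = 1..n. a i) in \<Sum>i = 1..n. a i * lg (s / a i))"

end

theory Submission imports Defs
begin

text \<open>
  With \<open>\<phi>(a, b) = (a - b) ln (a - b) - a ln a + b ln a = (a - b) ln ((a - b) / a)\<close>, the quantity
  inside the absolute value is \<open>(\<phi>(m, k) - (\<Sum>i. \<phi>(d\<^sub>i, x\<^sub>i))) / ln 2\<close>. The bounds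
  \<open>1 - 1/t \<le> ln t \<le> 0\<close> for \<open>0 < t \<le> 1\<close> give \<open>-b \<le> \<phi>(a, b) \<le> 0\<close>, so both \<open>\<phi>(m, k)\<close> and the sum lie in \<open>[-k, 0]\<close>,
  and the difference is at most \<open>k / ln 2\<close> in absolute value.
\<close>

lemma ln_increment_bounds:
  fixes a b :: real
  assumes "0 \<le> b" "b \<le> a"
  shows "(a - b) * ln (a - b) - a * ln a + b * ln a \<in> {-b..0}"
\<comment> \<open>For \<open>b = a\<close> the quotient below would divide by zero; here the
  expression is just \<open>0 - a * ln a + a * ln a\<close>.\<close>
proof (cases "b = a")
  case True
  then show ?thesis using assms by simp
next
  case False
  then have pos: "0 < a - b" "0 < a" using assms by auto
  \<comment> \<open>Inverting the quotient makes the logarithm nonnegative, so that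
    \<open>ln u \<le> u - 1\<close> yields the lower bound \<open>-b\<close>.\<close>
  have eq: "(a - b) * ln (a - b) - a * ln a + b * ln a = - ((a - b) * ln (a / (a - b)))"
    using pos by (simp add: ln_div algebra_simps)
  have "0 \<le> ln (a / (a - b))"
    using pos assms by (intro ln_ge_zero) (simp add: field_simps)
  moreover have "ln (a / (a - b)) \<le> a / (a - b) - 1"
    using pos by (intro ln_le_minus_one) simp
  then have "(a - b) * ln (a / (a - b)) \<le> (a - b) * (a / (a - b) - 1)"
    using pos by (intro mult_left_mono) auto
  moreover have "(a - b) * (a / (a - b) - 1) = b"
    using pos by (simp add: field_simps)
  ultimately show ?thesis using pos by (simp add: eq)
qed

text \<open>Once each \<open>ln (s / a i)\<close> is split, the parts \<open>a i * ln s\<close> add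
  up to \<open>s * ln s\<close>. The factor \<open>ln 2\<close> turns \<open>lg\<close> into
  \<open>ln\<close>.\<close>

lemma H_times_ln_2:
  assumes "\<And>i. i \<in> {1..n} \<Longrightarrow> 0 \<le> a i"
  shows "H n a * ln 2 = (\<Sum>i = 1..n. a i) * ln (\<Sum>i = 1..n. a i) - (\<Sum>i = 1..n. a i * ln (a i))"
proof -
  define s where "s = (\<Sum>i = 1..n. a i)"
  have "a i * lg (s / a i) * ln 2 = a i * ln s - a i * ln (a i)" if i: "i \<in> {1..n}" for i
  proof (cases "a i = 0")
    case False
    then have "0 < a i" using assms[OF i] by simp
    \<comment> \<open>This makes \<open>s\<close> positive, so the logarithm of the quotient
      splits.\<close>
    moreover have "a i \<le> s"
      unfolding s_def using i assms by (intro member_le_sum) auto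
    ultimately show ?thesis by (simp add: log_def ln_div right_diff_distrib)
  qed simp
  then have "H n a * ln 2 = (\<Sum>i = 1..n. a i * ln s - a i * ln (a i))"
    by (simp add: H_def Let_def sum_distrib_right flip: s_def del: One_nat_def)
  also have "\<dots> = s * ln s - (\<Sum>i = 1..n. a i * ln (a i))"
    by (simp add: sum_subtractf s_def sum_distrib_right)
  finally show ?thesis by (simp add: s_def)
qed

theorem theorem22:
  fixes n k m :: nat and d x :: "nat \<Rightarrow> nat"
  assumes "m = (\<Sum>i = 1..n. d i)"
    and "k > 0"
    and "\<And>i. i \<in> {1..n} \<Longrightarrow> x i \<le> d i"
    and "(\<Sum>i = 1..n. x i) = k"
  shows "\<bar>H n (\<lambda>i. real (d i) - real (x i)) - H n (\<lambda>i. real (d i))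
           - (\<Sum>i = 1..n. real (x i) * lg (real (d i) / real m))\<bar> \<le> 2 * real k / ln 2"
    (is "\<bar>?D\<bar> \<le> _")
proof -
  define \<phi> :: "real \<Rightarrow> real \<Rightarrow> real"
    where "\<phi> a b = (a - b) * ln (a - b) - a * ln a + b * ln a" for a b
  have sums: "(\<Sum>i = 1..n. real (d i)) = real m" "(\<Sum>i = 1..n. real (x i)) = real k"
    using assms(1,4) by (simp_all flip: of_nat_sum)
  have km: "k \<le> m" using assms(1,3,4) by (metis sum_mono)
  have Hdx: "H n (\<lambda>i. real (d i) - real (x i)) * ln 2 = (real m - real k) * ln (real m - real k)
      - (\<Sum>i = 1..n. (real (d i) - real (x i)) * ln (real (d i) - real (x i)))"
    using assms(3) by (subst H_times_ln_2) (simp_all add: sum_subtractf sums del: One_nat_def)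
  have Hd: "H n (\<lambda>i. real (d i)) * ln 2 = real m * ln (real m)
      - (\<Sum>i = 1..n. real (d i) * ln (real (d i)))"
    by (subst H_times_ln_2) (simp_all add: sums del: One_nat_def)
  \<comment> \<open>If \<open>d i = 0\<close>, then \<open>x i = 0\<close> and both sides vanish;
    otherwise \<open>m \<ge> k > 0\<close> allows the split.\<close>
  have "real (x i) * lg (real (d i) / real m) * ln 2
      = real (x i) * ln (real (d i)) - real (x i) * ln (real m)" if "i \<in> {1..n}" for i
    using assms(2) assms(3)[OF that] km
    by (cases "d i = 0") (auto simp: log_def ln_div right_diff_distrib)
  then have lin: "(\<Sum>i = 1..n. real (x i) * lg (real (d i) / real m)) * ln 2
      = (\<Sum>i = 1..n. real (x i) * ln (real (d i))) - real k * ln (real m)"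
    by (simp add: sum_distrib_right sum_subtractf flip: sums(2))
  \<comment> \<open>The linear term supplies the summands \<open>b * ln a\<close> of
    \<open>\<phi>\<close>: \<open>k * ln m\<close> for the total and \<open>x i * ln (d i)\<close>
    for each index.\<close>
  have D: "?D * ln 2 = \<phi> (real m) (real k) - (\<Sum>i = 1..n. \<phi> (real (d i)) (real (x i)))"
    unfolding left_diff_distrib[of _ _ "ln 2"] Hdx Hd lin
    by (simp add: \<phi>_def sum.distrib sum_subtractf)
  have \<phi>m: "\<phi> (real m) (real k) \<in> {- real k..0}"
    unfolding \<phi>_def using km by (intro ln_increment_bounds) auto
  have \<phi>i: "\<phi> (real (d i)) (real (x i)) \<in> {- real (x i)..0}" if "i \<in> {1..n}" for i
    unfolding \<phi>_def using assms(3)[OF that] by (intro ln_increment_bounds) auto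
  have "(\<Sum>i = 1..n. \<phi> (real (d i)) (real (x i))) \<le> 0"
    using \<phi>i by (intro sum_nonpos) auto
  \<comment> \<open>The lower bounds add up to exactly \<open>-k\<close>, so the sum lies in the
    same interval as \<open>\<phi> m k\<close>.\<close>
  moreover have "(\<Sum>i = 1..n. - real (x i)) \<le> (\<Sum>i = 1..n. \<phi> (real (d i)) (real (x i)))"
    using \<phi>i by (intro sum_mono) auto
  ultimately have "\<bar>?D * ln 2\<bar> \<le> 2 * real k"
    unfolding D using \<phi>m by (auto simp: sum_negf sums simp del: One_nat_def)
  then show ?thesis
    by (simp add: abs_mult pos_le_divide_eq)
qed

end
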